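(* Let $(X,Y)$ be a uniformly focusing channel with finite input alphabet $\mathcal{X}$ and finite output alphabet $\mathcal{Y}$, let $n = |\mathcal{X}| \ge 2$, and suppose that the input $X$ follows the uniform distribution on $\mathcal{X}$. Put $\hat{\mathbf{v}}_n(X\mid Y) := \mathbf{v}_n\bigl(H_{\mathbf{v}_n}^{-1}(H(X\mid Y))\bigr)$, $\hat{\mathbf{w}}_n(X\mid Y) := \mathbf{w}_n\bigl(H_{\mathbf{w}_n}^{-1}(H(X\mid Y))\bigr)$, and $$E_0^{(\mathbf{v}_n)}(\rho,X,Y) := \rho\, D_{\frac1{1+\rho}}\bigl(\hat{\mathbf{v}}_n(X\mid Y)\,\big\|\,\mathbf{u}_n\bigr),\qquad E_0^{(\mathbf{w}_n)}(\rho,X,Y) := \rho\, D_{\frac1{1+\rho}}\bigl(\hat{\mathbf{w}}_n(X\mid Y)\,\big\|\,\mathbf{u}_n\bigr).$$ Then for every $\rho\in(-1,\infty)$, $$E_0^{(\mathbf{v}_n)}(\rho,X,Y) \le E_0(\rho,X,Y) \le E_0^{(\mathbf{w}_n)}(\rho,X,Y).$$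
   Context: A channel $(X,Y)$ is a discrete memoryless channel: $X\in\mathcal{X}$ is the input with distribution $P_X$, $Y\in\mathcal{Y}$ is the output, $\mathcal X,\mathcal Y$ are finite, and $P_{Y|X}(y\mid x)$ are the transition probabilities. It is uniformly focusing if for each $y\in\mathcal{Y}$ there is a permutation $\pi_y:\mathcal{X}\to\mathcal{X}$ such that $P_{Y|X}(y\mid\pi_y(x)) = P_{Y|X}(y'\mid\pi_{y'}(x))$ for all $(x,y,y')\in\mathcal{X}\times\mathcal{Y}^2$. Gallager's $E_0$ function is $E_0(\rho,X,Y) = -\ln\sum_{y\in\mathcal{Y}}\Bigl(\sum_{x\in\mathcal{X}}P_X(x)P_{Y|X}(y\mid x)^{\frac1{1+\rho}}\Bigr)^{1+\rho}$ for $\rho\in(-1,\infty)$. $\mathcal{P}_n = \{(p_1,\dots,p_n)\in\mathbb{R}^n : p_i \ge 0,\ \sum_i p_i = 1\}$; $\mathbf{u}_n = (\frac1n,\dots,\frac1n)$. The Shannon entropy is $H(\mathbf{p}) = -\sum_i p_i \ln p_i$ with $0\ln 0=0$ (natural logarithm). The conditional Shannon entropy is $H(X\mid Y) = \mathbb{E}[H(P_{X|Y}(\cdot\mid Y))] = \sum_{y} P_Y(y) H(P_{X|Y}(\cdot\mid y))$, where $P_{X|Y}$ is the posterior distribution. The Rényi divergence of order $\alpha\in(0,1)\cup(1,\infty)$ is $D_\alpha(\mathbf{p}\,\|\,\mathbf{q}) = \frac1{\alpha-1}\ln\sum_{i=1}^n p_i^\alpha q_i^{1-\alpha}$, and $D_1(\mathbf{p}\,\|\,\mathbf{q})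 = \sum_i p_i\ln\frac{p_i}{q_i}$ is the relative entropy. For $p\in[0,\frac1{n-1}]$, $\mathbf{v}_n(p) = (1-(n-1)p,\, p,\, \dots,\, p) \in \mathcal{P}_n$. For $p \in [\frac1n, 1]$, $\mathbf{w}_n(p) = (w_1(p),\dots,w_n(p)) \in \mathcal{P}_n$ with $w_i(p) = p$ if $1\le i\le \lfloor p^{-1}\rfloor$, $w_i(p) = 1-\lfloor p^{-1}\rfloor p$ if $i = \lfloor p^{-1}\rfloor + 1$, and $w_i(p)=0$ otherwise. Write $H_{\mathbf{v}_n}(p) = H(\mathbf{v}_n(p))$ and $H_{\mathbf{w}_n}(p) = H(\mathbf{w}_n(p))$. The function $H_{\mathbf{v}_n}$ is a strictly increasing bijection $[0,\frac1n]\to[0,\ln n]$ with inverse $H_{\mathbf{v}_n}^{-1}$; the function $H_{\mathbf{w}_n}$ is a strictly decreasing bijection $[\frac1n,1]\to[0,\ln n]$ with inverse $H_{\mathbf{w}_n}^{-1}$. *)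

theory Defs
  imports "HOL-Probability.Probability_Mass_Function"
begin

text \<open>
  A discrete memoryless channel with finite alphabets is given by an input distribution
  \<open>PX :: 'x pmf\<close> and transition probabilities \<open>W :: 'x \<Rightarrow> 'y pmf\<close>, where \<open>pmf (W x) y\<close> is the
  probability of output \<open>y\<close> given input \<open>x\<close>; the alphabets are the finite types \<open>'x\<close> and \<open>'y\<close>.
\<close>

definition uniformly_focusing :: "('x \<Rightarrow> 'y pmf) \<Rightarrow> bool" where
  "uniformly_focusing W \<longleftrightarrow>
     (\<exists>\<pi> :: 'y \<Rightarrow> 'x \<Rightarrow> 'x. (\<forall>y. bij (\<pi> y)) \<and>
        (\<forall>x y y'. pmf (W (\<pi> y x)) y = pmf (W (\<pi> y' x)) y'))"

definition gallager_E0 :: "real \<Rightarrow> 'x::finite pmf \<Rightarrow> ('x \<Rightarrow> 'y::finite pmf) \<Rightarrow> real" where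
  "gallager_E0 \<rho> PX W =
     - ln (\<Sum>y\<in>UNIV. (\<Sum>x\<in>UNIV. pmf PX x * pmf (W x) y powr (1 / (1 + \<rho>))) powr (1 + \<rho>))"

text \<open>
  Probability vectors are real functions on an explicit index set \<open>A\<close>: \<open>UNIV\<close> for distributions
  on the input alphabet, \<open>{1..n}\<close> for vectors in \<open>\<real>\<^sup>n\<close>.
  The convention \<open>0 * ln 0 = 0\<close> holds automatically.
\<close>

definition shannon_entropy :: "'i set \<Rightarrow> ('i \<Rightarrow> real) \<Rightarrow> real" where
  "shannon_entropy A p = - (\<Sum>i\<in>A. p i * ln (p i))"

definition output_pmf :: "'x pmf \<Rightarrow> ('x \<Rightarrow> 'y pmf) \<Rightarrow> 'y pmf" where
  "output_pmf PX W = bind_pmf PX W"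

text \<open>
  If \<open>y\<close> has output probability 0, this is the zero function; such \<open>y\<close> have weight 0 in the
  conditional entropy.
\<close>

definition posterior :: "'x pmf \<Rightarrow> ('x \<Rightarrow> 'y pmf) \<Rightarrow> 'y \<Rightarrow> 'x \<Rightarrow> real" where
  "posterior PX W y x = pmf PX x * pmf (W x) y / pmf (output_pmf PX W) y"

definition cond_shannon_entropy :: "'x::finite pmf \<Rightarrow> ('x \<Rightarrow> 'y::finite pmf) \<Rightarrow> real" where
  "cond_shannon_entropy PX W =
     (\<Sum>y\<in>UNIV. pmf (output_pmf PX W) y * shannon_entropy UNIV (posterior PX W y))"

definition renyi_divergence :: "'i set \<Rightarrow> real \<Rightarrow> ('i \<Rightarrow> real) \<Rightarrow> ('i \<Rightarrow> real) \<Rightarrow> real" where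
  "renyi_divergence A \<alpha> p q =
     (if \<alpha> = 1 then \<Sum>i\<in>A. p i * ln (p i / q i)
      else 1 / (\<alpha> - 1) * ln (\<Sum>i\<in>A. p i powr \<alpha> * q i powr (1 - \<alpha>)))"

definition u_vec :: "nat \<Rightarrow> nat \<Rightarrow> real" where
  "u_vec n i = 1 / real n"

definition v_vec :: "nat \<Rightarrow> real \<Rightarrow> nat \<Rightarrow> real" where
  "v_vec n p i = (if i = 1 then 1 - (real n - 1) * p else p)"

text \<open>
  The entries of the vector \<open>w\<close> do not depend on its length \<open>n\<close>; for \<open>1 / n \<le> p \<le> 1\<close> the
  restriction to \<open>{1..n}\<close> is a probability vector.
\<close>

definition w_vec :: "real \<Rightarrow> nat \<Rightarrow> real" where
  "w_vec p i =
     (if int i \<le> \<lfloor>1 / p\<rfloor> then p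
      else if int i = \<lfloor>1 / p\<rfloor> + 1 then 1 - of_int \<lfloor>1 / p\<rfloor> * p
      else 0)"

definition H_v :: "nat \<Rightarrow> real \<Rightarrow> real" where
  "H_v n p = shannon_entropy {1..n} (v_vec n p)"

definition H_w :: "nat \<Rightarrow> real \<Rightarrow> real" where
  "H_w n p = shannon_entropy {1..n} (w_vec p)"

text \<open>
  For \<open>n \<ge> 2\<close>, \<open>H_v n\<close> is a bijection from \<open>{0..1 / n}\<close> onto \<open>{0..ln n}\<close> and \<open>H_w n\<close> is a bijection
  from \<open>{1 / n..1}\<close> onto \<open>{0..ln n}\<close>, so on \<open>{0..ln n}\<close> the following are their inverses.
\<close>

definition H_v_inv :: "nat \<Rightarrow> real \<Rightarrow> real" where
  "H_v_inv n = inv_into {0..1 / real n} (H_v n)"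

definition H_w_inv :: "nat \<Rightarrow> real \<Rightarrow> real" where
  "H_w_inv n = inv_into {1 / real n..1} (H_w n)"

definition v_hat :: "'x::finite pmf \<Rightarrow> ('x \<Rightarrow> 'y::finite pmf) \<Rightarrow> nat \<Rightarrow> real" where
  "v_hat PX W = v_vec CARD('x) (H_v_inv CARD('x) (cond_shannon_entropy PX W))"

definition w_hat :: "'x::finite pmf \<Rightarrow> ('x \<Rightarrow> 'y::finite pmf) \<Rightarrow> nat \<Rightarrow> real" where
  "w_hat PX W = w_vec (H_w_inv CARD('x) (cond_shannon_entropy PX W))"

definition E0_v :: "real \<Rightarrow> 'x::finite pmf \<Rightarrow> ('x \<Rightarrow> 'y::finite pmf) \<Rightarrow> real" where
  "E0_v \<rho> PX W =
     \<rho> * renyi_divergence {1..CARD('x)} (1 / (1 + \<rho>)) (v_hat PX W) (u_vec CARD('x))"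

definition E0_w :: "real \<Rightarrow> 'x::finite pmf \<Rightarrow> ('x \<Rightarrow> 'y::finite pmf) \<Rightarrow> real" where
  "E0_w \<rho> PX W =
     \<rho> * renyi_divergence {1..CARD('x)} (1 / (1 + \<rho>)) (w_hat PX W) (u_vec CARD('x))"

end

theory Submission
  imports Defs "HOL-Real_Asymp.Real_Asymp"
begin

text \<open>
  For a uniformly focusing channel with uniform input all posteriors are permutations of one
  probability vector \<open>p\<close>, so \<open>H(X | Y) = H(p)\<close>, and with \<open>\<alpha> = 1 / (1 + \<rho>)\<close> each of the three
  quantities equals \<open>\<rho> * ln n - (1 + \<rho>) * ln (\<Sum>i. q i powr \<alpha>)\<close>, where \<open>q\<close> is \<open>v\<close>, \<open>p\<close> or \<open>w\<close>. It
  remains to see that \<open>v\<close> maximises and \<open>w\<close> minimises the power sum among vectors of equal entropy.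

  Subtracting a combination of \<open>x\<close> and \<open>x * ln x\<close> from \<open>x powr \<alpha>\<close> changes the power sums by equal
  amounts. For any \<open>0 < s < t\<close> the combination can be chosen such that the difference \<open>\<psi>\<close> increases up
  to \<open>s\<close>, decreases up to \<open>t\<close> and increases afterwards. For \<open>v = (z, b, \<dots>, b)\<close> take \<open>s = b\<close> and
  \<open>t = max p\<close>; for \<open>w = (a, \<dots>, a, r, 0, \<dots>)\<close> with \<open>k\<close> entries \<open>a\<close> take \<open>t = a\<close> and for \<open>s\<close> the
  \<open>(k + 1)\<close>-st largest entry of \<open>p\<close>. Then the values of \<open>\<psi>\<close> compare entry by entry.
\<close>

section \<open>Continuity and tangent bounds for \<open>x * ln x\<close>\<close>

definition xlog :: "real \<Rightarrow> real" where
  "xlog x = x * ln x"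

lemma xlog_0 [simp]: "xlog 0 = 0" and xlog_1 [simp]: "xlog 1 = 0"
  by (simp_all add: xlog_def)

text \<open>The absolute values make the function two-sided at 0, where both one-sided limits
  vanish; on \<open>{0..}\<close> it agrees with \<open>xlog\<close>.\<close>

lemma isCont_abs_xlog: "isCont (\<lambda>x. \<bar>x\<bar> * ln \<bar>x\<bar>) (x::real)"
proof (cases "x = 0")
  case True
  have "((\<lambda>x::real. \<bar>x\<bar> * ln \<bar>x\<bar>) \<longlongrightarrow> 0) (at_left 0)" by real_asymp
  moreover have "((\<lambda>x::real. \<bar>x\<bar> * ln \<bar>x\<bar>) \<longlongrightarrow> 0) (at_right 0)" by real_asymp
  ultimately show ?thesis
    using True by (simp add: isCont_def filterlim_split_at)
qed (auto intro!: continuous_intros)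

lemma continuous_on_xlog: "continuous_on {0..} xlog"
proof -
  have "continuous_on {0..} (\<lambda>x::real. \<bar>x\<bar> * ln \<bar>x\<bar>)"
    by (intro continuous_at_imp_continuous_on ballI isCont_abs_xlog)
  thus ?thesis
    by (rule continuous_on_cong[THEN iffD1, rotated -1]) (auto simp: xlog_def)
qed

lemma continuous_on_xlog_comp:
  assumes "continuous_on S f" "\<And>x. x \<in> S \<Longrightarrow> 0 \<le> f x"
  shows "continuous_on S (\<lambda>x. xlog (f x))"
  by (rule continuous_on_compose2[OF continuous_on_xlog assms(1)]) (use assms(2) in auto)

lemma xlog_above_tangent:
  assumes "0 \<le> x" "0 < a"
  shows "xlog a + (1 + ln a) * (x - a) \<le> xlog x"
proof (cases "x = 0")
  case False
  with assms have "ln a - ln x \<le> (a - x) / x" by (intro ln_diff_le) auto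
  hence "x * (ln a - ln x) \<le> a - x" using assms False by (simp add: field_simps)
  thus ?thesis by (simp add: xlog_def algebra_simps)
qed (use assms in \<open>simp add: xlog_def algebra_simps\<close>)

lemma xlog_above_tangent_strict:
  assumes "0 \<le> x" "0 < a" "x \<noteq> a"
  shows "xlog a + (1 + ln a) * (x - a) < xlog x"
proof (cases "x = 0")
  case False
  with assms have "ln a - ln x < (a - x) / x" by (intro ln_diff_less) auto
  hence "x * (ln a - ln x) < a - x" using assms False by (simp add: field_simps)
  thus ?thesis by (simp add: xlog_def algebra_simps)
qed (use assms in \<open>simp add: xlog_def algebra_simps\<close>)

section \<open>Interpolation of the power function by \<open>x\<close> and
  \<open>x * ln x\<close>\<close>

text \<open>The three-point form \<open>three\<close> of convexity, applied to \<open>a\<close>,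
  \<open>b\<close> and \<open>x\<close> in their three possible orders, determines the sign of
  \<open>h x\<close>.\<close>

lemma convex_on_two_zeros:
  fixes h :: "real \<Rightarrow> real"
  assumes "convex_on UNIV h" "h a = 0" "h b = 0" "a < b"
  shows "\<lbrakk>a \<le> x; x \<le> b\<rbrakk> \<Longrightarrow> h x \<le> 0" and "x \<le> a \<Longrightarrow> 0 \<le> h x" and "b \<le> x \<Longrightarrow> 0 \<le> h x"
proof -
  have three: "(z - x) * h y \<le> (z - y) * h x + (y - x) * h z" if "x < y" "y < z" for x y z
  proof -
    define l where "l = (y - x) / (z - x)"
    have l: "0 \<le> l" "l \<le> 1" "(z - x) * l = y - x" using that by (auto simp: l_def)
    hence "(1 - l) * x + l * z = y" by (simp add: algebra_simps)
    hence "h y \<le> (1 - l) * h x + l * h z"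
      using convex_onD[OF assms(1), of l x z] l by simp
    hence "(z - x) * h y \<le> (z - x) * ((1 - l) * h x + l * h z)"
      using that by (intro mult_left_mono) auto
    also have "\<dots> = ((z - x) - (z - x) * l) * h x + (z - x) * l * h z"
      by (simp add: algebra_simps)
    also have "\<dots> = (z - y) * h x + (y - x) * h z"
      using l(3) by simp
    finally show ?thesis .
  qed
  show "h x \<le> 0" if "a \<le> x" "x \<le> b"
    using three[of a x b] that assms(2-4)
    by (cases "x = a \<or> x = b") (auto simp: mult_le_0_iff)
  show "0 \<le> h x" if "x \<le> a"
    using three[of x a b] that assms(2-4)
    by (cases "x = a") (auto simp: zero_le_mult_iff)
  show "0 \<le> h x" if "b \<le> x"
    using three[of a b x] that assms(2-4)
    by (cases "x = b") (auto simp: zero_le_mult_iff)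
qed

text \<open>
  In the variable \<open>ln x\<close> the derivative of the function below is a convex function minus an affine
  one; \<open>A\<close> and \<open>B\<close> are chosen such that it vanishes at \<open>s\<close> and \<open>t\<close>.
\<close>

lemma powr_xlog_interpolation:
  fixes \<alpha> s t :: real
  assumes "0 < \<alpha>" "0 < s" "s < t"
  obtains A B where
    "\<And>x y. \<lbrakk>0 \<le> x; x \<le> y; y \<le> s\<rbrakk> \<Longrightarrow>
       x powr \<alpha> - A * x - B * xlog x \<le> y powr \<alpha> - A * y - B * xlog y"
    "\<And>x y. \<lbrakk>s \<le> x; x \<le> y; y \<le> t\<rbrakk> \<Longrightarrow>
       y powr \<alpha> - A * y - B * xlog y \<le> x powr \<alpha> - A * x - B * xlog x"
    "\<And>x y. \<lbrakk>t \<le> x; x \<le> y\<rbrakk> \<Longrightarrow>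
       x powr \<alpha> - A * x - B * xlog x \<le> y powr \<alpha> - A * y - B * xlog y"
proof -
  \<comment> \<open>\<open>c (ln x)\<close> is the derivative of \<open>x powr \<alpha>\<close>, and
    \<open>h (ln x)\<close> that of \<open>\<psi>\<close>. The number \<open>B\<close> is the slope
    of the chord of \<open>c\<close> from \<open>ln s\<close> to \<open>ln t\<close>, and
    \<open>A\<close> shifts the line onto that chord.\<close>
  define c where "c = (\<lambda>\<sigma>. \<alpha> * exp ((\<alpha> - 1) * \<sigma>))"
  define B where "B = (c (ln t) - c (ln s)) / (ln t - ln s)"
  define A where "A = c (ln s) - B * ln s - B"
  define h where "h = (\<lambda>\<sigma>. c \<sigma> - (A + B) - B * \<sigma>)"
  define \<psi> where "\<psi> = (\<lambda>x. x powr \<alpha> - A * x - B * xlog x)"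
  have lt: "ln s < ln t" using assms by simp
  have "h (ln s) = 0" by (simp add: h_def A_def)
  have "h (ln t) = c (ln t) - c (ln s) - B * (ln t - ln s)" by (simp add: h_def A_def algebra_simps)
  also have "\<dots> = 0" using lt by (simp add: B_def)
  finally have "h (ln t) = 0" .
  have "convex_on UNIV h"
  proof (rule f''_ge0_imp_convex)
    show "DERIV h x :> \<alpha> * (\<alpha> - 1) * exp ((\<alpha> - 1) * x) - B" for x
      unfolding h_def c_def by (auto intro!: derivative_eq_intros)
    show "DERIV (\<lambda>x. \<alpha> * (\<alpha> - 1) * exp ((\<alpha> - 1) * x) - B) x :> \<alpha> * (\<alpha> - 1)\<^sup>2 * exp ((\<alpha> - 1) * x)" for x
      by (auto intro!: derivative_eq_intros simp: power2_eq_square)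
  qed (use assms in auto)
  note sgn = convex_on_two_zeros[OF this \<open>h (ln s) = 0\<close> \<open>h (ln t) = 0\<close> lt]
  have deriv: "(\<psi> has_real_derivative h (ln x)) (at x)" if "0 < x" for x
  proof -
    have "x powr (\<alpha> - 1) = exp ((\<alpha> - 1) * ln x)" using that by (simp add: powr_def)
    thus ?thesis using that unfolding \<psi>_def h_def c_def xlog_def
      by (auto intro!: derivative_eq_intros simp: algebra_simps)
  qed
  \<comment> \<open>At 0 the derivative can fail to exist; continuity on the closed interval and
    derivatives inside it suffice for monotonicity.\<close>
  have cont: "continuous_on {x..y} \<psi>" if "0 \<le> x" for x y
    unfolding \<psi>_def using that assms
    by (intro continuous_intros continuous_on_powr' continuous_on_xlog_comp) auto
  have "\<psi> x \<le> \<psi> y" if "0 \<le> x" "x \<le> y" "y \<le> s" for x y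
  proof (rule DERIV_nonneg_imp_increasing_open[where f = \<psi> and a = x and b = y])
    show "\<exists>d. DERIV \<psi> u :> d \<and> 0 \<le> d" if "x < u" "u < y" for u
      using deriv[of u] sgn(2)[of "ln u"] \<open>0 \<le> x\<close> \<open>y \<le> s\<close> that assms by auto
  qed (use that cont in auto)
  moreover have "\<psi> y \<le> \<psi> x" if "s \<le> x" "x \<le> y" "y \<le> t" for x y
  proof (rule DERIV_nonpos_imp_decreasing_open[where f = \<psi> and a = x and b = y])
    show "\<exists>d. DERIV \<psi> u :> d \<and> d \<le> 0" if "x < u" "u < y" for u
      using deriv[of u] sgn(1)[of "ln u"] \<open>s \<le> x\<close> \<open>y \<le> t\<close> that assms by auto
  qed (use that cont assms in auto)
  moreover have "\<psi> x \<le> \<psi> y" if "t \<le> x" "x \<le> y" for x y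
  proof (rule DERIV_nonneg_imp_increasing_open[where f = \<psi> and a = x and b = y])
    show "\<exists>d. DERIV \<psi> u :> d \<and> 0 \<le> d" if "x < u" "u < y" for u
      using deriv[of u] sgn(3)[of "ln u"] \<open>t \<le> x\<close> that assms by auto
  qed (use that cont assms in auto)
  ultimately show thesis using that[of A B] unfolding \<psi>_def by blast
qed

section \<open>Extremal power sums at fixed entropy\<close>

lemma finite_obtains_max:
  fixes f :: "'i \<Rightarrow> 'a::linorder"
  assumes "finite I" "I \<noteq> {}"
  obtains m where "m \<in> I" "\<And>i. i \<in> I \<Longrightarrow> f i \<le> f m"
proof -
  have "Max (f ` I) \<in> f ` I" using assms by simp
  then obtain m where "m \<in> I" "Max (f ` I) = f m" by auto
  with assms show thesis using that by (metis Max_ge finite_imageI imageI)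
qed

text \<open>The largest entry \<open>p m\<close> is compared with \<open>z\<close> and every other
  entry with \<open>b\<close>, where \<open>\<psi>\<close> is maximal on \<open>[0, p m]\<close>. In
  the two cases split off, \<open>b = 0\<close> and \<open>p m \<le> b\<close>, no nodes
  \<open>0 < b < p m\<close> exist; \<open>p\<close> is then a point mass or uniform.\<close>

lemma sum_powr_le_one_large:
  fixes p :: "'i \<Rightarrow> real"
  assumes "finite I" "2 \<le> card I" and p: "\<And>i. i \<in> I \<Longrightarrow> 0 \<le> p i" "sum p I = 1"
    and b: "0 \<le> b" "b \<le> 1 / card I" and z: "z = 1 - (real (card I) - 1) * b"
    and ent: "(\<Sum>i\<in>I. xlog (p i)) = xlog z + (real (card I) - 1) * xlog b"
    and "0 < \<alpha>"
  shows "(\<Sum>i\<in>I. p i powr \<alpha>) \<le> z powr \<alpha> + (real (card I) - 1) * b powr \<alpha>"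
proof -
  let ?n = "real (card I)"
  have n: "2 \<le> ?n" using assms by simp
  have "?n * b \<le> 1" using b n by (simp add: field_simps)
  hence bz: "b \<le> z" by (simp add: z algebra_simps)
  have "0 < z"
  proof (rule ccontr)
    assume "\<not> 0 < z"
    with bz b have "b = 0" "z = 0" by auto
    thus False using z by simp
  qed
  have "I \<noteq> {}" using assms by auto
  then obtain m where m: "m \<in> I" "\<And>i. i \<in> I \<Longrightarrow> p i \<le> p m"
    using finite_obtains_max[OF \<open>finite I\<close>, of p] by blast
  have split: "sum f I = f m + sum f (I - {m})" for f :: "'i \<Rightarrow> real"
    by (rule sum.remove) (use m assms in auto)
  have card_rest: "real (card (I - {m})) = ?n - 1" using m assms by (simp add: of_nat_diff)
  have p_le_1: "p i \<le> 1" if "i \<in> I" for i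
    using member_le_sum[of i I p] p that assms by auto
  show ?thesis
  proof (cases "b = 0")
    case True
    hence "z = 1" by (simp add: z)
    hence "(\<Sum>i\<in>I. - xlog (p i)) = 0" using ent True by (simp add: sum_negf)
    moreover have "0 \<le> - xlog (p i)" if "i \<in> I" for i
      using p(1)[OF that] p_le_1[OF that]
      by (cases "p i = 0") (auto simp: xlog_def mult_nonneg_nonpos)
    ultimately have "xlog (p i) = 0" if "i \<in> I" for i
      using that sum_nonneg_eq_0_iff[of I "\<lambda>i. - xlog (p i)"] assms by auto
    hence "p i = 0 \<or> p i = 1" if "i \<in> I" for i
      using that p(1)[OF that] by (metis ln_eq_zero_iff mult_eq_0_iff order_le_less xlog_def)
    hence "p i powr \<alpha> = p i" if "i \<in> I" for i
      using that by fastforce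
    thus ?thesis using p True \<open>z = 1\<close> by simp
  next
    case False
    hence "0 < b" using b by simp
    \<comment> \<open>If \<open>p m > z\<close>, tangents at \<open>b\<close> for the other entries
      and a strict one at \<open>z\<close> for \<open>p m\<close> make the sum of
      \<open>xlog (p i)\<close> exceed the prescribed value, because the slope at \<open>z\<close>
      is at least the slope at \<open>b\<close>.\<close>
    have "p m \<le> z"
    proof (rule ccontr)
      assume *: "\<not> p m \<le> z"
      have rest: "sum p (I - {m}) - (?n - 1) * b = z - p m"
        using split[of p] p z by simp
      have "(\<Sum>i\<in>I-{m}. xlog b + (1 + ln b) * (p i - b)) \<le> (\<Sum>i\<in>I-{m}. xlog (p i))"
        using p \<open>0 < b\<close> by (intro sum_mono xlog_above_tangent) auto
      also have "(\<Sum>i\<in>I-{m}. xlog b + (1 + ln b) * (p i - b)) =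
          (?n - 1) * xlog b + (1 + ln b) * (sum p (I - {m}) - (?n - 1) * b)"
        by (simp add: sum.distrib sum_distrib_left[symmetric] sum_subtractf card_rest)
      finally have "(?n - 1) * xlog b + (1 + ln b) * (z - p m) \<le> (\<Sum>i\<in>I-{m}. xlog (p i))"
        unfolding rest .
      moreover have "xlog z + (1 + ln z) * (p m - z) < xlog (p m)"
        using * \<open>0 < z\<close> by (intro xlog_above_tangent_strict) auto
      ultimately have "(1 + ln z) * (p m - z) + (1 + ln b) * (z - p m) < 0"
        using ent split[of "\<lambda>i. xlog (p i)"] by linarith
      hence "(ln z - ln b) * (p m - z) < 0" by (simp add: algebra_simps)
      moreover have "0 \<le> (ln z - ln b) * (p m - z)"
        using * bz \<open>0 < b\<close> by (intro mult_nonneg_nonneg) auto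
      ultimately show False by simp
    qed
    show ?thesis
    proof (cases "p m \<le> b")
      case True
      \<comment> \<open>All entries are at most their mean \<open>1 / ?n\<close>, hence equal to
        it.\<close>
      have le: "p i \<le> 1 / ?n" if "i \<in> I" for i using m(2)[OF that] True b by linarith
      have "(\<Sum>i\<in>I. 1 / ?n - p i) = 0" using p n by (simp add: sum_subtractf)
      hence eq: "p i = 1 / ?n" if "i \<in> I" for i
        using that le sum_nonneg_eq_0_iff[of I "\<lambda>i. 1 / ?n - p i"] assms by auto
      hence "b = 1 / ?n" using True m b by force
      moreover from this have "z = b" using n by (simp add: z field_simps)
      ultimately show ?thesis using eq by (simp add: algebra_simps)
    next
      case False
      from powr_xlog_interpolation[OF \<open>0 < \<alpha>\<close> \<open>0 < b\<close>, of "p m"] False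
      obtain A B where AB:
        "\<And>x y. \<lbrakk>0 \<le> x; x \<le> y; y \<le> b\<rbrakk> \<Longrightarrow>
           x powr \<alpha> - A * x - B * xlog x \<le> y powr \<alpha> - A * y - B * xlog y"
        "\<And>x y. \<lbrakk>b \<le> x; x \<le> y; y \<le> p m\<rbrakk> \<Longrightarrow>
           y powr \<alpha> - A * y - B * xlog y \<le> x powr \<alpha> - A * x - B * xlog x"
        "\<And>x y. \<lbrakk>p m \<le> x; x \<le> y\<rbrakk> \<Longrightarrow>
           x powr \<alpha> - A * x - B * xlog x \<le> y powr \<alpha> - A * y - B * xlog y"
        by (metis linorder_not_le)
      define \<psi> where "\<psi> = (\<lambda>x. x powr \<alpha> - A * x - B * xlog x)"
      have "\<psi> (p i) \<le> \<psi> b" if "i \<in> I" for i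
        using AB(1)[of "p i" b] AB(2)[of b "p i"] m(2)[OF that] p(1)[OF that]
        by (cases "p i \<le> b") (auto simp: \<psi>_def)
      hence "(\<Sum>i\<in>I-{m}. \<psi> (p i)) \<le> (\<Sum>i\<in>I-{m}. \<psi> b)"
        by (intro sum_mono) auto
      moreover have "\<psi> (p m) \<le> \<psi> z"
        using AB(3) \<open>p m \<le> z\<close> by (simp add: \<psi>_def)
      ultimately have "(\<Sum>i\<in>I. \<psi> (p i)) \<le> \<psi> z + (?n - 1) * \<psi> b"
        using split[of "\<lambda>i. \<psi> (p i)"] card_rest by simp
      \<comment> \<open>Both vectors have total 1 and equal \<open>xlog\<close> sums, so the terms
        with \<open>A\<close> and \<open>B\<close> cancel.\<close>
      moreover have "(\<Sum>i\<in>I. \<psi> (p i)) =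
          (\<Sum>i\<in>I. p i powr \<alpha>) - A * sum p I - B * (\<Sum>i\<in>I. xlog (p i))"
        by (simp add: \<psi>_def sum_subtractf sum_distrib_left)
      moreover have "A * (z + (?n - 1) * b) = A" by (simp add: z)
      moreover have "\<psi> z + (?n - 1) * \<psi> b = z powr \<alpha> + (?n - 1) * b powr \<alpha>
          - A * (z + (?n - 1) * b) - B * (xlog z + (?n - 1) * xlog b)"
        by (simp add: \<psi>_def algebra_simps)
      ultimately show ?thesis using p ent by simp
    qed
  qed
qed

text \<open>A substitute for sorting: each step adds a maximal remaining entry.\<close>

lemma exists_k_largest:
  fixes p :: "'i \<Rightarrow> real"
  assumes "finite I" "k \<le> card I"
  shows "\<exists>S\<subseteq>I. card S = k \<and> (\<forall>i\<in>S. \<forall>j\<in>I-S. p j \<le> p i)"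
  using assms(2)
proof (induction k)
  case (Suc k)
  then obtain S where S: "S \<subseteq> I" "card S = k" "\<forall>i\<in>S. \<forall>j\<in>I-S. p j \<le> p i" by auto
  have fin: "finite (I - S)" "finite S" using assms S by (auto intro: finite_subset)
  have "I - S \<noteq> {}" using S Suc.prems assms by (metis Diff_eq_empty_iff card_mono fin(2) not_less_eq_eq)
  then obtain m where m: "m \<in> I - S" "\<And>i. i \<in> I - S \<Longrightarrow> p i \<le> p m"
    using finite_obtains_max[OF fin(1), of p] by blast
  have "card (insert m S) = Suc k" using m S fin by simp
  thus ?case using m S by (intro exI[of _ "insert m S"]) auto
qed (auto intro!: exI[of _ "{}"])

text \<open>The \<open>k\<close> largest entries are compared with \<open>a\<close>, the next one,
  \<open>p m\<close>, with \<open>r\<close>, and the rest with 0. Here \<open>\<psi>\<close> is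
  minimal at \<open>a\<close> among arguments from \<open>p m\<close> on, maximal at
  \<open>p m\<close> on \<open>[0, a]\<close>, and nonnegative on \<open>[0, p m]\<close> because
  \<open>\<psi> 0 = 0\<close>.\<close>

lemma sum_powr_ge_blocks:
  fixes p :: "'i \<Rightarrow> real"
  assumes "finite I" and p: "\<And>i. i \<in> I \<Longrightarrow> 0 \<le> p i" "sum p I = 1"
    and k: "k \<le> card I" and a: "0 < a" and r: "r = 1 - real k * a" "0 \<le> r" "r < a"
    and ent: "(\<Sum>i\<in>I. xlog (p i)) = real k * xlog a + xlog r"
    and "0 < \<alpha>"
  shows "real k * a powr \<alpha> + r powr \<alpha> \<le> (\<Sum>i\<in>I. p i powr \<alpha>)"
proof -
  obtain S where S: "S \<subseteq> I" "card S = k" "\<And>i j. i \<in> S \<Longrightarrow> j \<in> I - S \<Longrightarrow> p j \<le> p i"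
    using exists_k_largest[OF \<open>finite I\<close> k, of p] by blast
  have fin: "finite S" "finite (I - S)" using S assms by (auto intro: finite_subset)
  have splitS: "sum f I = sum f S + sum f (I - S)" for f :: "'i \<Rightarrow> real"
    using sum.subset_diff[OF S(1) \<open>finite I\<close>, of f] by simp
  show ?thesis
  proof (cases "\<forall>j\<in>I-S. p j = 0")
    \<comment> \<open>Here the interpolation node would be 0; strictness of the tangent bound forces \<open>p = w\<close>.\<close>
    case True
    hence "sum p S = 1" and xS: "(\<Sum>i\<in>S. xlog (p i)) = real k * xlog a + xlog r"
      using splitS[of p] splitS[of "\<lambda>i. xlog (p i)"] p ent by simp_all
    \<comment> \<open>\<open>d\<close> is the gap between \<open>xlog\<close> and its tangent at
      \<open>a\<close>. Its sum over \<open>S\<close> is \<open>r * (ln r - ln a - 1)\<close>,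
      negative for \<open>0 < r < a\<close>; hence \<open>r = 0\<close> and every gap
      vanishes.\<close>
    define d where "d = (\<lambda>i. xlog (p i) - (xlog a + (1 + ln a) * (p i - a)))"
    have d_nonneg: "0 \<le> d i" if "i \<in> S" for i
      using xlog_above_tangent[of "p i" a] p(1)[of i] that S a by (auto simp: d_def)
    have "sum d S = real k * xlog a + xlog r - (real k * xlog a + (1 + ln a) * (sum p S - k * a))"
      by (simp add: d_def sum.distrib sum_subtractf sum_distrib_left[symmetric] S xS)
    also have "\<dots> = xlog r - (1 + ln a) * r"
      using \<open>sum p S = 1\<close> by (simp add: r)
    finally have d_sum: "sum d S = xlog r - (1 + ln a) * r" .
    have "r = 0"
    proof (rule ccontr)
      assume "r \<noteq> 0"
      hence "0 < r" using r by simp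
      have "ln r * r \<le> ln a * r" using \<open>0 < r\<close> r by simp
      hence "sum d S < 0" using d_sum \<open>0 < r\<close> unfolding xlog_def by argo
      thus False using d_nonneg sum_nonneg[of S d] by force
    qed
    hence "sum d S = 0" using d_sum by simp
    hence "d i = 0" if "i \<in> S" for i
      using that d_nonneg sum_nonneg_eq_0_iff[of S d] fin by auto
    hence "p i = a" if "i \<in> S" for i
      using xlog_above_tangent_strict[of "p i" a] p(1)[of i] that S a by (fastforce simp: d_def)
    thus ?thesis using splitS[of "\<lambda>i. p i powr \<alpha>"] True \<open>r = 0\<close> S by simp
  next
    case False
    hence "I - S \<noteq> {}" by auto
    then obtain m where m: "m \<in> I - S" "\<And>i. i \<in> I - S \<Longrightarrow> p i \<le> p m"
      using finite_obtains_max[OF fin(2), of p] by blast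
    obtain j where "j \<in> I - S" "p j \<noteq> 0" using False by auto
    hence pos: "0 < p m" using m(2)[of j] p(1)[of j] by auto
    have splitm: "sum f I = sum f S + f m + sum f (I - S - {m})" for f :: "'i \<Rightarrow> real"
      using splitS[of f] sum.remove[of "I - S" m f] m fin by simp
    \<comment> \<open>Otherwise \<open>k + 1\<close> entries would be at least \<open>a\<close>,
      while \<open>(k + 1) * a > 1\<close> by \<open>r < a\<close>.\<close>
    have "p m < a"
    proof (rule ccontr)
      assume *: "\<not> p m < a"
      have "real k * a \<le> sum p S"
        using sum_bounded_below[of S a p] S(2) S(3)[OF _ m(1)] * by force
      moreover have "0 \<le> sum p (I - S - {m})" using p by (intro sum_nonneg) auto
      ultimately show False using splitm[of p] p r * by simp
    qed
    from powr_xlog_interpolation[OF \<open>0 < \<alpha>\<close> pos this]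
    obtain A B where AB:
      "\<And>x y. \<lbrakk>0 \<le> x; x \<le> y; y \<le> p m\<rbrakk> \<Longrightarrow>
         x powr \<alpha> - A * x - B * xlog x \<le> y powr \<alpha> - A * y - B * xlog y"
      "\<And>x y. \<lbrakk>p m \<le> x; x \<le> y; y \<le> a\<rbrakk> \<Longrightarrow>
         y powr \<alpha> - A * y - B * xlog y \<le> x powr \<alpha> - A * x - B * xlog x"
      "\<And>x y. \<lbrakk>a \<le> x; x \<le> y\<rbrakk> \<Longrightarrow>
         x powr \<alpha> - A * x - B * xlog x \<le> y powr \<alpha> - A * y - B * xlog y"
      by blast
    define \<psi> where "\<psi> = (\<lambda>x. x powr \<alpha> - A * x - B * xlog x)"
    have "\<psi> a \<le> \<psi> (p i)" if "i \<in> S" for i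
      using AB(2)[of "p i" a] AB(3)[of a "p i"] S(3)[OF that m(1)]
      by (cases "p i \<le> a") (auto simp: \<psi>_def)
    hence "real k * \<psi> a \<le> (\<Sum>i\<in>S. \<psi> (p i))"
      using sum_bounded_below[of S "\<psi> a" "\<lambda>i. \<psi> (p i)"] S by simp
    moreover have "\<psi> r \<le> \<psi> (p m)"
      using AB(1)[of r "p m"] AB(2)[of "p m" r] r by (cases "r \<le> p m") (auto simp: \<psi>_def)
    moreover have "0 \<le> (\<Sum>i\<in>I-S-{m}. \<psi> (p i))"
      using AB(1)[of 0] m(2) p by (intro sum_nonneg) (auto simp: \<psi>_def)
    ultimately have "real k * \<psi> a + \<psi> r \<le> (\<Sum>i\<in>I. \<psi> (p i))"
      using splitm[of "\<lambda>i. \<psi> (p i)"] by simp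
    moreover have "(\<Sum>i\<in>I. \<psi> (p i)) =
        (\<Sum>i\<in>I. p i powr \<alpha>) - A * sum p I - B * (\<Sum>i\<in>I. xlog (p i))"
      by (simp add: \<psi>_def sum_subtractf sum_distrib_left)
    moreover have "A * (real k * a + r) = A" by (simp add: r)
    moreover have "real k * \<psi> a + \<psi> r = real k * a powr \<alpha> + r powr \<alpha>
        - A * (real k * a + r) - B * (real k * xlog a + xlog r)"
      by (simp add: \<psi>_def algebra_simps)
    ultimately show ?thesis using p ent by simp
  qed
qed


section \<open>Sums over \<open>v_vec\<close> and \<open>w_vec\<close>, and surjectivity of their
  entropies\<close>

text \<open>\<open>\<phi>\<close> is left general to serve both \<open>xlog\<close> and
  powers.\<close>

lemma sum_v_vec:
  fixes \<phi> :: "real \<Rightarrow> real"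
  assumes "1 \<le> n"
  shows "(\<Sum>i\<in>{1..n}. \<phi> (v_vec n b i)) = \<phi> (1 - (real n - 1) * b) + (real n - 1) * \<phi> b"
proof -
  have "(\<Sum>i\<in>{1..n}. \<phi> (v_vec n b i)) = \<phi> (v_vec n b 1) + (\<Sum>i\<in>{1..n}-{1}. \<phi> (v_vec n b i))"
    by (rule sum.remove) (use assms in auto)
  also have "(\<Sum>i\<in>{1..n}-{1}. \<phi> (v_vec n b i)) = (\<Sum>i\<in>{1..n}-{1}. \<phi> b)"
    by (rule sum.cong) (auto simp: v_vec_def)
  finally show ?thesis using assms by (simp add: v_vec_def of_nat_diff)
qed

text \<open>\<open>k\<close> is the floor of \<open>1 / a\<close>, and \<open>\<phi> 0 = 0\<close>
  removes the trailing zeros. For \<open>k = n\<close> no position is left for the remainder, which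
  \<open>last\<close> makes 0.\<close>

lemma sum_w_vec:
  fixes \<phi> :: "real \<Rightarrow> real"
  assumes "\<phi> 0 = 0" and k: "real k * a \<le> 1" "1 < (real k + 1) * a" "k \<le> n" and "0 < a"
    and last: "k = n \<Longrightarrow> real k * a = 1"
  shows "(\<Sum>i\<in>{1..n}. \<phi> (w_vec a i)) = real k * \<phi> a + \<phi> (1 - real k * a)"
proof -
  have "\<lfloor>1 / a\<rfloor> = int k"
    using k \<open>0 < a\<close> by (intro floor_unique) (auto simp: field_simps)
  hence w: "w_vec a i = (if i \<le> k then a else if i = k + 1 then 1 - real k * a else 0)" for i
    by (auto simp: w_vec_def)
  have "(\<Sum>i\<in>{1..n}. \<phi> (w_vec a i)) = (\<Sum>i\<in>{1..k}. \<phi> (w_vec a i)) + (\<Sum>i\<in>{k<..n}. \<phi> (w_vec a i))"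
    using k by (subst sum.union_disjoint[symmetric]) (auto intro!: sum.cong)
  also have "(\<Sum>i\<in>{1..k}. \<phi> (w_vec a i)) = real k * \<phi> a"
    by (simp add: w)
  also have "(\<Sum>i\<in>{k<..n}. \<phi> (w_vec a i)) = (\<Sum>i\<in>{k<..n}. if i = k + 1 then \<phi> (1 - real k * a) else 0)"
    using assms(1) by (intro sum.cong) (auto simp: w)
  also have "\<dots> = \<phi> (1 - real k * a)"
    using k last assms(1) by (cases "k = n") auto
  finally show ?thesis .
qed

lemma xlog_inverse_nat: "real k * xlog (1 / real k) = - ln (real k)"
  by (cases "k = 0") (auto simp: xlog_def ln_div)

text \<open>Surjectivity makes \<open>inv_into\<close> a right inverse of \<open>H_v n\<close>. It
  follows from the intermediate value theorem, the entropy being 0 at \<open>b = 0\<close> and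
  \<open>ln n\<close> at \<open>b = 1 / n\<close>.\<close>

lemma H_v_surj:
  assumes "1 \<le> n" "0 \<le> h" "h \<le> ln (real n)"
  shows "h \<in> H_v n ` {0..1 / real n}"
proof -
  define g where "g = (\<lambda>b. - (xlog (1 - (real n - 1) * b) + (real n - 1) * xlog b))"
  have H: "H_v n = g"
    using sum_v_vec[OF assms(1), of xlog]
    by (simp add: fun_eq_iff H_v_def shannon_entropy_def g_def xlog_def)
  have "1 - (real n - 1) * (1 / real n) = 1 / real n" using assms by (simp add: field_simps)
  hence "g (1 / real n) = - (real n * xlog (1 / real n))" by (simp add: g_def algebra_simps)
  hence "g (1 / real n) = ln (real n)" by (simp add: xlog_inverse_nat)
  moreover have "g 0 = 0" by (simp add: g_def)
  moreover have "continuous_on {0..1 / real n} g"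
  proof -
    have "0 \<le> 1 - (real n - 1) * b" if "b \<in> {0..1 / real n}" for b
    proof -
      have "(real n - 1) * b \<le> real n * b" using that by (simp add: algebra_simps)
      also have "\<dots> \<le> 1" using that assms by (simp add: field_simps)
      finally show ?thesis by simp
    qed
    thus ?thesis unfolding g_def
      by (intro continuous_intros continuous_on_xlog_comp) auto
  qed
  ultimately obtain b where "0 \<le> b" "b \<le> 1 / real n" "g b = h"
    using IVT'[of g 0 h "1 / real n"] assms by auto
  thus ?thesis unfolding H by auto
qed

lemma H_w_eq:
  assumes "real k * a \<le> 1" "1 < (real k + 1) * a" "k \<le> n" "0 < a" "k = n \<Longrightarrow> real k * a = 1"
  shows "H_w n a = - (real k * xlog a + xlog (1 - real k * a))"
  using sum_w_vec[of xlog k a n] assms by (simp add: H_w_def shannon_entropy_def xlog_def)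

lemma H_w_inverse_nat:
  assumes "1 \<le> k" "k \<le> n"
  shows "H_w n (1 / real k) = ln (real k)"
  using H_w_eq[of k "1 / real k" n] assms xlog_inverse_nat[of k] by (simp add: field_simps)

text \<open>The floor in \<open>w_vec\<close> jumps at reciprocals of integers, so the intermediate
  value theorem is applied to a single formula \<open>g\<close> between \<open>1 / (k + 1)\<close>
  and \<open>1 / k\<close>. The end values are \<open>ln (k + 1)\<close> and \<open>ln k\<close>,
  which is why \<open>k\<close> is the floor of \<open>exp h\<close>.\<close>

lemma H_w_surj:
  assumes "1 \<le> n" "0 \<le> h" "h \<le> ln (real n)"
  shows "h \<in> H_w n ` {1 / real n..1}"
proof (cases "h = ln (real n)")
  case True
  thus ?thesis using H_w_inverse_nat[of n n] assms by (intro image_eqI[of _ _ "1 / real n"]) auto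
next
  case False
  define k where "k = nat \<lfloor>exp h\<rfloor>"
  have "1 \<le> exp h" using assms by simp
  hence k1: "1 \<le> k" "real k \<le> exp h" "exp h < real k + 1"
    unfolding k_def by linarith+
  have "exp h < real n" using False assms by (metis exp_less_mono exp_ln less_eq_real_def of_nat_0_less_iff less_le_trans zero_less_one)
  hence kn: "k < n" using k1 by linarith
  define g where "g = (\<lambda>a. - (real k * xlog a + xlog (1 - real k * a)))"
  have gk: "g (1 / real k) = ln (real k)"
    using k1 xlog_inverse_nat[of k] by (simp add: g_def)
  have "1 - real k * (1 / real (Suc k)) = 1 / real (Suc k)" by (simp add: field_simps)
  hence "g (1 / real (Suc k)) = - (real k * xlog (1 / real (Suc k)) + xlog (1 / real (Suc k)))"
    by (simp only: g_def)
  also have "\<dots> = - (real (Suc k) * xlog (1 / real (Suc k)))"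
    by (simp add: algebra_simps)
  finally have gSk: "g (1 / real (Suc k)) = ln (real (Suc k))" by (simp only: xlog_inverse_nat)
  have lnk: "ln (real k) \<le> h" "h \<le> ln (real (Suc k))"
    using k1 ln_mono[of "real k" "exp h"] ln_mono[of "exp h" "real (Suc k)"] by simp_all
  have "continuous_on {1 / real (Suc k)..1 / real k} g" unfolding g_def
  proof (intro continuous_intros continuous_on_xlog_comp)
    fix a assume "a \<in> {1 / real (Suc k)..1 / real k}"
    thus "0 \<le> a" "0 \<le> 1 - real k * a"
      using k1 by (auto simp: field_simps intro: order_trans[rotated])
  qed
  with gk gSk lnk obtain a where a: "1 / real (Suc k) \<le> a" "a \<le> 1 / real k" "g a = h"
    using IVT2'[of g "1 / real k" h "1 / real (Suc k)"] k1 by (auto simp: frac_le)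
  have "1 / real n \<le> 1 / real (Suc k)" using kn by (intro divide_left_mono) auto
  moreover have "1 / real k \<le> 1" using k1 by simp
  ultimately have mem: "a \<in> {1 / real n..1}" using a by auto
  have "H_w n a = h"
  \<comment> \<open>At the left end the floor is already \<open>k + 1\<close> and the formula for
    \<open>k\<close> does not apply directly, but \<open>g\<close> and \<open>H_w n\<close> both
    equal \<open>ln (k + 1)\<close> there.\<close>
  proof (cases "a = 1 / real (Suc k)")
    case True
    thus ?thesis using H_w_inverse_nat[of "Suc k" n] kn gSk a by simp
  next
    case False
    hence "1 / real (Suc k) < a" using a by simp
    hence "1 < (real k + 1) * a" by (simp add: field_simps)
    moreover have "real k * a \<le> 1" using a k1 by (simp add: field_simps)
    moreover have "0 < a" using \<open>1 / real (Suc k) < a\<close> by (rule less_trans[rotated]) simp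
    ultimately show ?thesis using H_w_eq[of k a n] kn a by (simp add: g_def)
  qed
  with mem show ?thesis by auto
qed

section \<open>Entropy bounds and comparison with the vectors of equal entropy\<close>

lemma shannon_entropy_bounds:
  fixes p :: "'i \<Rightarrow> real"
  assumes "finite I" and p: "\<And>i. i \<in> I \<Longrightarrow> 0 \<le> p i" "sum p I = 1"
  shows "0 \<le> shannon_entropy I p" "shannon_entropy I p \<le> ln (real (card I))"
proof -
  have le1: "p i \<le> 1" if "i \<in> I" for i
    using member_le_sum[of i I p] p that assms by auto
  have "p i * ln (p i) \<le> 0" if "i \<in> I" for i
    using p(1)[OF that] le1[OF that] by (cases "p i = 0") (auto simp: mult_nonneg_nonpos)
  thus "0 \<le> shannon_entropy I p" by (simp add: shannon_entropy_def sum_nonpos)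
  have "I \<noteq> {}" using p by auto
  hence n: "0 < card I" using assms by (simp add: card_gt_0_iff)
  let ?u = "1 / real (card I)"
  \<comment> \<open>Tangent at the uniform value; the linear terms cancel because the differences
    \<open>p i - ?u\<close> sum to 0.\<close>
  have "(\<Sum>i\<in>I. xlog ?u + (1 + ln ?u) * (p i - ?u)) \<le> (\<Sum>i\<in>I. xlog (p i))"
    using p n by (intro sum_mono xlog_above_tangent) auto
  moreover have "(\<Sum>i\<in>I. xlog ?u + (1 + ln ?u) * (p i - ?u)) =
      real (card I) * xlog ?u + (1 + ln ?u) * (sum p I - real (card I) * ?u)"
    by (simp only: sum.distrib sum_distrib_left[symmetric] sum_subtractf sum_constant)
  ultimately show "shannon_entropy I p \<le> ln (real (card I))"
    using n p xlog_inverse_nat[of "card I"] by (simp add: shannon_entropy_def xlog_def)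
qed

lemma sum_powr_le_v_vec:
  fixes p :: "'i \<Rightarrow> real"
  assumes "finite I" and n: "n = card I" "2 \<le> n"
    and p: "\<And>i. i \<in> I \<Longrightarrow> 0 \<le> p i" "sum p I = 1" and "0 < \<alpha>"
  shows "(\<Sum>i\<in>I. p i powr \<alpha>) \<le> (\<Sum>i\<in>{1..n}. v_vec n (H_v_inv n (shannon_entropy I p)) i powr \<alpha>)"
proof -
  define b where "b = H_v_inv n (shannon_entropy I p)"
  have img: "shannon_entropy I p \<in> H_v n ` {0..1 / real n}"
    using shannon_entropy_bounds[OF \<open>finite I\<close> p] n by (intro H_v_surj) auto
  have b: "b \<in> {0..1 / real n}" "H_v n b = shannon_entropy I p"
    unfolding b_def H_v_inv_def using inv_into_into[OF img] f_inv_into_f[OF img] by simp_all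
  have "(\<Sum>i\<in>I. xlog (p i)) = xlog (1 - (real n - 1) * b) + (real n - 1) * xlog b"
    using b(2) sum_v_vec[of n xlog b] n by (simp add: H_v_def shannon_entropy_def xlog_def)
  from sum_powr_le_one_large[OF \<open>finite I\<close> _ p _ _ refl this[unfolded n] \<open>0 < \<alpha>\<close>] b n
  show ?thesis
    using sum_v_vec[of n "\<lambda>x. x powr \<alpha>" b] by (simp add: b_def)
qed

lemma sum_powr_ge_w_vec:
  fixes p :: "'i \<Rightarrow> real"
  assumes "finite I" and n: "n = card I"
    and p: "\<And>i. i \<in> I \<Longrightarrow> 0 \<le> p i" "sum p I = 1" and "0 < \<alpha>"
  defines "w \<equiv> w_vec (H_w_inv n (shannon_entropy I p))"
  shows "(\<Sum>i\<in>{1..n}. w i powr \<alpha>) \<le> (\<Sum>i\<in>I. p i powr \<alpha>)" "0 < (\<Sum>i\<in>{1..n}. w i powr \<alpha>)"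
proof -
  define a where "a = H_w_inv n (shannon_entropy I p)"
  have "I \<noteq> {}" using p by auto
  hence n1: "1 \<le> n" using assms by (simp add: Suc_le_eq card_gt_0_iff)
  have img: "shannon_entropy I p \<in> H_w n ` {1 / real n..1}"
    using shannon_entropy_bounds[OF \<open>finite I\<close> p] n n1 by (intro H_w_surj) auto
  have a: "1 / real n \<le> a" "a \<le> 1" "H_w n a = shannon_entropy I p"
    unfolding a_def H_w_inv_def using inv_into_into[OF img] f_inv_into_f[OF img] by simp_all
  have "0 < a" using a(1) n1 by (intro less_le_trans[OF _ a(1)]) auto
  define k where "k = nat \<lfloor>1 / a\<rfloor>"
  have "1 \<le> 1 / a" using \<open>0 < a\<close> a by simp
  hence "1 \<le> k" "real k \<le> 1 / a" "1 / a < real k + 1" unfolding k_def by linarith+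
  hence k: "1 \<le> k" "real k * a \<le> 1" "1 < (real k + 1) * a"
    using \<open>0 < a\<close> by (simp_all add: field_simps)
  have "1 / a \<le> real n" using a(1) \<open>0 < a\<close> n1 by (simp add: field_simps)
  hence kn: "k \<le> n" using \<open>real k \<le> 1 / a\<close> by linarith
  have last: "real k * a = 1" if "k = n" using that a(1) n1 k by (simp add: field_simps)
  have ent: "(\<Sum>i\<in>I. xlog (p i)) = real k * xlog a + xlog (1 - real k * a)"
    using a(3) H_w_eq[OF k(2,3) kn \<open>0 < a\<close> last] by (simp add: shannon_entropy_def xlog_def)
  have w: "(\<Sum>i\<in>{1..n}. w i powr \<alpha>) = real k * a powr \<alpha> + (1 - real k * a) powr \<alpha>"
    using sum_w_vec[of "\<lambda>x. x powr \<alpha>", OF _ k(2,3) kn \<open>0 < a\<close> last] by (simp add: w_def a_def)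
  show "(\<Sum>i\<in>{1..n}. w i powr \<alpha>) \<le> (\<Sum>i\<in>I. p i powr \<alpha>)"
    unfolding w
    by (rule sum_powr_ge_blocks[OF \<open>finite I\<close> p _ \<open>0 < a\<close> refl _ _ ent \<open>0 < \<alpha>\<close>])
      (use k kn n in \<open>auto simp: algebra_simps\<close>)
  show "0 < (\<Sum>i\<in>{1..n}. w i powr \<alpha>)"
    unfolding w using k \<open>0 < a\<close> by (intro add_pos_nonneg mult_pos_pos) auto
qed

section \<open>Reduction of divergences and channel quantities to power sums\<close>

text \<open>For \<open>\<alpha> = 1 / (1 + \<rho>)\<close> the prefactor
  \<open>\<rho> / (\<alpha> - 1)\<close> is \<open>- (1 + \<rho>)\<close>, and \<open>u_vec\<close>
  contributes the factor \<open>n powr (\<alpha> - 1)\<close>. At \<open>\<rho> = 0\<close> the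
  order is 1, where the divergence has its other formula.\<close>

lemma renyi_divergence_u_vec:
  assumes "0 < n" "-1 < \<rho>" "\<rho> \<noteq> 0" and T: "0 < (\<Sum>i\<in>{1..n}. q i powr (1 / (1 + \<rho>)))"
  shows "\<rho> * renyi_divergence {1..n} (1 / (1 + \<rho>)) q (u_vec n) =
    \<rho> * ln (real n) - (1 + \<rho>) * ln (\<Sum>i\<in>{1..n}. q i powr (1 / (1 + \<rho>)))"
proof -
  define \<alpha> where "\<alpha> = 1 / (1 + \<rho>)"
  let ?T = "\<Sum>i\<in>{1..n}. q i powr \<alpha>"
  have \<alpha>: "\<alpha> \<noteq> 1" "\<rho> * (1 / (\<alpha> - 1)) = - (1 + \<rho>)" "(1 + \<rho>) * (1 - \<alpha>) = \<rho>"
    using assms by (simp_all add: \<alpha>_def field_simps)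
  have "ln (\<Sum>i\<in>{1..n}. q i powr \<alpha> * u_vec n i powr (1 - \<alpha>)) = ln (?T * (1 / real n) powr (1 - \<alpha>))"
    by (simp add: u_vec_def sum_distrib_right)
  also have "\<dots> = ln ?T - (1 - \<alpha>) * ln (real n)"
    using assms by (simp add: ln_mult ln_powr ln_div \<alpha>_def)
  finally have "\<rho> * renyi_divergence {1..n} \<alpha> q (u_vec n) =
      \<rho> * (1 / (\<alpha> - 1)) * (ln ?T - (1 - \<alpha>) * ln (real n))"
    using \<alpha>(1) by (simp add: renyi_divergence_def)
  also have "\<dots> = ((1 + \<rho>) * (1 - \<alpha>)) * ln (real n) - (1 + \<rho>) * ln ?T"
    unfolding \<alpha>(2) by (simp add: algebra_simps)
  finally show ?thesis unfolding \<alpha>(3) by (simp add: \<alpha>_def)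
qed

text \<open>The columns are permutations of one another. Suitable \<open>\<phi>\<close> make column
  sums, posterior entropies and Gallager's inner sums independent of the output.\<close>

lemma uniformly_focusing_sum_eq:
  fixes W :: "'x::finite \<Rightarrow> 'y::finite pmf" and \<phi> :: "real \<Rightarrow> real"
  assumes "uniformly_focusing W"
  shows "(\<Sum>x\<in>UNIV. \<phi> (pmf (W x) y)) = (\<Sum>x\<in>UNIV. \<phi> (pmf (W x) y'))"
proof -
  obtain \<pi> :: "'y \<Rightarrow> 'x \<Rightarrow> 'x" where \<pi>: "\<And>y. bij (\<pi> y)" "\<And>x y y'. pmf (W (\<pi> y x)) y = pmf (W (\<pi> y' x)) y'"
    using assms unfolding uniformly_focusing_def by blast
  have "(\<Sum>x\<in>UNIV. \<phi> (pmf (W x) y)) = (\<Sum>x\<in>UNIV. \<phi> (pmf (W (\<pi> y x)) y))" for y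
    by (rule sum.reindex_bij_betw[symmetric, OF \<pi>(1)])
  from this[of y] this[of y'] show ?thesis
    by (simp add: \<pi>(2)[of y _ y'])
qed

text \<open>\<open>p\<close> is the posterior given a reference output \<open>y\<^sub>0\<close>
  under uniform input: the inputs have weight \<open>1 / n\<close>, and the outputs turn out to have
  weight \<open>1 / m\<close>.\<close>

locale uniform_focusing_channel =
  fixes W :: "'x::finite \<Rightarrow> 'y::finite pmf" and n m :: nat and y\<^sub>0 :: 'y and p :: "'x \<Rightarrow> real"
  assumes foc: "uniformly_focusing W"
  defines "n \<equiv> CARD('x)" and "m \<equiv> CARD('y)"
    and "p \<equiv> \<lambda>x. pmf (W x) y\<^sub>0 * (real m / real n)"
begin

lemma n_pos: "0 < n" and m_pos: "0 < m"
  by (auto simp: n_def m_def card_gt_0_iff)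

text \<open>Double counting: each of the \<open>n\<close> rows sums to 1, and all \<open>m\<close>
  columns have the same sum.\<close>

lemma column_sum: "(\<Sum>x\<in>UNIV. pmf (W x) y) = real n / real m"
proof -
  have "(\<Sum>y\<in>UNIV. pmf (W x) y) = 1" for x
    by (rule sum_pmf_eq_1) auto
  hence "real n = (\<Sum>x\<in>UNIV. \<Sum>y\<in>UNIV. pmf (W x) y)" by (simp add: n_def)
  also have "\<dots> = (\<Sum>y'\<in>UNIV. \<Sum>x\<in>UNIV. pmf (W x) y')" by (rule sum.swap)
  also have "\<dots> = (\<Sum>y'\<in>(UNIV::'y set). \<Sum>x\<in>UNIV. pmf (W x) y)"
    by (rule sum.cong[OF refl], rule uniformly_focusing_sum_eq[OF foc, of "\<lambda>t. t"])
  also have "\<dots> = real m * (\<Sum>x\<in>UNIV. pmf (W x) y)" by (simp add: m_def)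
  finally show ?thesis using m_pos by (simp add: field_simps)
qed

lemma p_nonneg: "0 \<le> p x"
  by (simp add: p_def)

lemma p_sum: "sum p UNIV = 1"
proof -
  have "sum p UNIV = (\<Sum>x\<in>UNIV. pmf (W x) y\<^sub>0) * (real m / real n)"
    by (simp only: p_def sum_distrib_right)
  thus ?thesis using column_sum[of y\<^sub>0] n_pos m_pos by simp
qed

lemma pmf_output: "pmf (output_pmf (pmf_of_set UNIV) W) y = 1 / real m"
  using column_sum[of y] n_pos m_pos
  by (simp add: output_pmf_def pmf_bind_pmf_of_set n_def pmf_bind integral_pmf_of_set)

lemma cond_entropy_eq: "cond_shannon_entropy (pmf_of_set UNIV) W = shannon_entropy UNIV p"
proof -
  have post: "posterior (pmf_of_set UNIV) W y x = pmf (W x) y * (real m / real n)" for x y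
    by (simp add: posterior_def pmf_output n_def)
  have "shannon_entropy UNIV (posterior (pmf_of_set UNIV) W y) = shannon_entropy UNIV p" for y
    using uniformly_focusing_sum_eq[OF foc, of "\<lambda>t. xlog (t * (real m / real n))" y y\<^sub>0]
    by (simp add: shannon_entropy_def post p_def xlog_def)
  thus ?thesis using m_pos by (simp add: cond_shannon_entropy_def pmf_output m_def)
qed

lemma sum_p_powr_pos: "0 < (\<Sum>x\<in>UNIV. p x powr \<alpha>)"
proof -
  obtain x where "p x \<noteq> 0" using p_sum by (metis sum.neutral zero_neq_one)
  thus ?thesis by (intro sum_pos2[of _ x]) auto
qed

text \<open>All inner sums equal \<open>S / n\<close>, so \<open>gallager_E0\<close> is minus the
  logarithm of \<open>m * (S / n) powr (1 + \<rho>)\<close>. Passing from \<open>S\<close> to the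
  power sum of \<open>p\<close> costs the factor \<open>(m / n) powr \<alpha>\<close>, and
  \<open>(1 + \<rho>) * \<alpha> = 1\<close> absorbs \<open>m\<close>.\<close>

lemma gallager_E0_eq:
  assumes "-1 < \<rho>"
  shows "gallager_E0 \<rho> (pmf_of_set UNIV) W =
    \<rho> * ln (real n) - (1 + \<rho>) * ln (\<Sum>x\<in>UNIV. p x powr (1 / (1 + \<rho>)))"
proof -
  define \<alpha> where "\<alpha> = 1 / (1 + \<rho>)"
  define S where "S = (\<Sum>x\<in>UNIV. pmf (W x) y\<^sub>0 powr \<alpha>)"
  have "(\<Sum>x\<in>UNIV. pmf (pmf_of_set UNIV) x * pmf (W x) y powr \<alpha>) = S / real n" for y
    using uniformly_focusing_sum_eq[OF foc, of "\<lambda>t. t powr \<alpha>" y y\<^sub>0]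
    by (simp add: S_def n_def flip: sum_divide_distrib)
  hence E0: "gallager_E0 \<rho> (pmf_of_set UNIV) W = - ln (real m * (S / real n) powr (1 + \<rho>))"
    by (simp add: gallager_E0_def \<alpha>_def m_def)
  have T: "(\<Sum>x\<in>UNIV. p x powr \<alpha>) = S * (real m / real n) powr \<alpha>"
    by (simp only: p_def S_def powr_mult sum_distrib_right)
  hence "0 < S" using sum_p_powr_pos[of \<alpha>] by (simp add: zero_less_mult_iff)
  have "ln (\<Sum>x\<in>UNIV. p x powr \<alpha>) = ln S + \<alpha> * (ln (real m) - ln (real n))"
    unfolding T using \<open>0 < S\<close> n_pos m_pos by (simp add: ln_mult ln_powr ln_div)
  hence "(1 + \<rho>) * ln (\<Sum>x\<in>UNIV. p x powr \<alpha>) =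
      (1 + \<rho>) * ln S + ((1 + \<rho>) * \<alpha>) * (ln (real m) - ln (real n))"
    by (simp only: distrib_left mult.assoc)
  also have "(1 + \<rho>) * \<alpha> = 1" using assms by (simp add: \<alpha>_def)
  finally show ?thesis
    unfolding E0 \<alpha>_def[symmetric] using \<open>0 < S\<close> n_pos m_pos
    by (simp add: ln_mult ln_powr ln_div algebra_simps)
qed

end

section \<open>Comparison of the three \<open>E0\<close> functions through their power sums\<close>

theorem theorem3:
  fixes PX :: "'x::finite pmf" and W :: "'x \<Rightarrow> 'y::finite pmf" and \<rho> :: real
  assumes "CARD('x) \<ge> 2"
    and "uniformly_focusing W"
    and "PX = pmf_of_set UNIV"
    and "\<rho> > -1"
  shows "E0_v \<rho> PX W \<le> gallager_E0 \<rho> PX W \<and> gallager_E0 \<rho> PX W \<le> E0_w \<rho> PX W"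
proof -
  define n where "n = CARD('x)"
  define \<alpha> where "\<alpha> = 1 / (1 + \<rho>)"
  have \<alpha>: "0 < \<alpha>" using assms by (simp add: \<alpha>_def)
  fix y :: 'y
  define p where "p = (\<lambda>x. pmf (W x) y * (real CARD('y) / real CARD('x)))"
  interpret ch: uniform_focusing_channel W "CARD('x)" "CARD('y)" y p
    by unfold_locales (use assms in \<open>auto simp: p_def\<close>)
  define V where "V = (\<Sum>i\<in>{1..n}. v_hat PX W i powr \<alpha>)"
  define T where "T = (\<Sum>x\<in>UNIV. p x powr \<alpha>)"
  define U where "U = (\<Sum>i\<in>{1..n}. w_hat PX W i powr \<alpha>)"
  have hats: "v_hat PX W = v_vec n (H_v_inv n (shannon_entropy UNIV p))"
    "w_hat PX W = w_vec (H_w_inv n (shannon_entropy UNIV p))"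
    using ch.cond_entropy_eq assms by (simp_all add: v_hat_def w_hat_def n_def)
  have "T \<le> V"
    unfolding T_def V_def hats using assms ch.p_nonneg ch.p_sum \<alpha>
    by (intro sum_powr_le_v_vec) (auto simp: n_def)
  have "U \<le> T" "0 < U"
    unfolding T_def U_def hats using ch.p_nonneg ch.p_sum \<alpha>
    by (intro sum_powr_ge_w_vec; auto simp: n_def)+
  have E0: "gallager_E0 \<rho> PX W = \<rho> * ln n - (1 + \<rho>) * ln T"
    using ch.gallager_E0_eq[of \<rho>] assms by (simp add: n_def T_def \<alpha>_def)
  show ?thesis
  proof (cases "\<rho> = 0")
    case True
    \<comment> \<open>Here \<open>\<alpha> = 1\<close>, so \<open>T\<close> is the total mass of
      \<open>p\<close> and all three quantities are 0.\<close>
    hence "T = 1" using ch.p_sum ch.p_nonneg by (simp add: T_def \<alpha>_def)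
    thus ?thesis using E0 True by (simp add: E0_v_def E0_w_def)
  next
    case False
    have "E0_v \<rho> PX W = \<rho> * ln n - (1 + \<rho>) * ln V" "E0_w \<rho> PX W = \<rho> * ln n - (1 + \<rho>) * ln U"
      using renyi_divergence_u_vec[of n \<rho>] False assms \<open>0 < U\<close> \<open>U \<le> T\<close> \<open>T \<le> V\<close>
      by (simp_all add: E0_v_def E0_w_def V_def U_def \<alpha>_def n_def)
    moreover have "ln T \<le> ln V" "ln U \<le> ln T"
      using \<open>0 < U\<close> \<open>U \<le> T\<close> \<open>T \<le> V\<close> by auto
    \<comment> \<open>The coefficient \<open>- (1 + \<rho>)\<close> is negative, so a larger power
      sum gives a smaller exponent.\<close>
    ultimately show ?thesis using E0 assms(4) by (simp add: mult_left_mono)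
  qed
qed

end
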